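(* Let $(\mathcal M,d)$ be any Hadamard space with the geodesic extension property, and let $A\subset\mathcal M$ be any subset of finite cardinality $k>0$ and diameter $\mu$. Fix any integer $n\ge 16$. Then the circumcenter subgradient algorithm, applied with input $A$ and $n$, terminates after computing $k(n+1)-1$ distances and $n$ convex combinations in $\mathcal M$, and returns a point whose distance from every point in $A$ exceeds the circumradius of $A$ by no more than $\frac{2\mu}{\sqrt n}$; that is, the returned point $x_{\mathrm{best}}$ satisfies \[ d(x_{\mathrm{best}},a)\;\le\;\min_{x\in\mathcal M}\max_{a'\in A}d(x,a')\;+\;\frac{2\mu}{\sqrt n}\qquad\text{for all } a\in A. \]
   Context: A Hadamard space is a complete CAT(0) space. A ray is a unit-speed geodesic ray $r\colon\mathbf R_+\to\mathcal M$. The space $\mathcal M$ has the geodesic extension property if for every geodesic segment $[x,y]$ in $\mathcal M$ there is a ray $r$ with $r(0)=x$ and $r(t)=y$ for some $t\ge0$. For $x,y\in\mathcal M$ and $\lambda\in[0,1]$, the convex combination $(1-\lambda)x+\lambda y$ is the point on the geodesic segment $[x,y]$ at distance $\lambda d(x,y)$ from $x$. For a nonempty finite set $A\subset\mathcal M$, the function $x\mapsto\max_{a\in A}d(x,a)$ has a unique minimizer over $\mathcal M$, the circumcenter of $A$; its minimum value is the circumradius of $A$. Circumcenter subgradient algorithm, with input a nonempty finite set $A\subset\mathcal M$ and an integer $n\ge16$: 1. Choose any $x\in A$. Set $x_{\mathrm{best}}=x$. Compute $\rho=\max\{d(a,x):a\in A\setminus\{x\}\}$ (with $\rho=0$ if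 $A=\{x\}$), using one distance computation for each $a\in A\setminus\{x\}$. Set $f_{\mathrm{best}}=\rho$ and $\epsilon=\frac{2\rho}{\sqrt n}$. 2. Repeat the following $n$ times: (i) Compute $d(a,x)$ for each $a\in A$ (one distance computation for each $a \in A$), set $\gamma=\max_{a\in A}d(a,x)$, and let $\hat a\in A$ be a point attaining this maximum (the first one encountered when looping over $A$). (ii) If $\gamma<f_{\mathrm{best}}$, set $f_{\mathrm{best}}=\gamma$ and $x_{\mathrm{best}}=x$. (iii) Set $\lambda=\frac{\epsilon}{\gamma}$ (with the convention $\lambda=0$ if $\gamma=0$, which can occur only when $A$ is a singleton), and replace $x$ by the convex combination $(1-\lambda)x+\lambda\hat a$. 3. Return $x_{\mathrm{best}}$. *)

theory Defs
  imports "HOL-Analysis.Analysis" "HOL-Library.Monad_Syntax"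
begin

text \<open>A metric space is given as a set \<open>M\<close> with the metric it inherits from the ambient
  type. Taking \<open>M = UNIV\<close> covers an arbitrary metric space.\<close>

definition geodesic_segment :: "'a::metric_space set \<Rightarrow> 'a \<Rightarrow> 'a \<Rightarrow> 'a set \<Rightarrow> bool" where
  "geodesic_segment M x y S \<longleftrightarrow>
     (\<exists>(c :: real \<Rightarrow> 'a) l. 0 \<le> l \<and> c 0 = x \<and> c l = y \<and>
        (\<forall>s\<in>{0..l}. \<forall>t\<in>{0..l}. dist (c s) (c t) = \<bar>s - t\<bar>) \<and> S = c ` {0..l} \<and> S \<subseteq> M)"

definition geodesic_ray :: "'a::metric_space set \<Rightarrow> (real \<Rightarrow> 'a) \<Rightarrow> bool" where
  "geodesic_ray M r \<longleftrightarrow>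
     r ` {0..} \<subseteq> M \<and> (\<forall>s\<in>{0..}. \<forall>t\<in>{0..}. dist (r s) (r t) = \<bar>s - t\<bar>)"

definition comparison_triangle ::
    "'a::metric_space \<Rightarrow> 'a \<Rightarrow> 'a \<Rightarrow> real^2 \<Rightarrow> real^2 \<Rightarrow> real^2 \<Rightarrow> bool" where
  "comparison_triangle x y z x' y' z' \<longleftrightarrow>
     dist x' y' = dist x y \<and> dist y' z' = dist y z \<and> dist z' x' = dist z x"

definition comparison_point ::
    "'a::metric_space \<Rightarrow> 'a \<Rightarrow> real^2 \<Rightarrow> real^2 \<Rightarrow> real^2 \<Rightarrow> bool" where
  "comparison_point x p x' y' p' \<longleftrightarrow> p' \<in> closed_segment x' y' \<and> dist x' p' = dist x p"

text \<open>Every geodesic triangle is at least as thin as its Euclidean comparison triangle. Two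
  points on different sides lie on sides with a common vertex, here called \<open>x\<close>; as all
  labellings of the triangle are quantified over, no pair of sides is missed. For two points on
  the same side the comparison is automatically an equality.\<close>

definition cat0_space :: "'a::metric_space set \<Rightarrow> bool" where
  "cat0_space M \<longleftrightarrow>
     (\<forall>x\<in>M. \<forall>y\<in>M. \<exists>S. geodesic_segment M x y S) \<and>
     (\<forall>x y z Sxy Syz Sxz x' y' z' p q p' q'.
        geodesic_segment M x y Sxy \<longrightarrow> geodesic_segment M y z Syz \<longrightarrow>
        geodesic_segment M x z Sxz \<longrightarrow> comparison_triangle x y z x' y' z' \<longrightarrow>
        p \<in> Sxy \<longrightarrow> comparison_point x p x' y' p' \<longrightarrow>
        q \<in> Sxz \<longrightarrow> comparison_point x q x' z' q' \<longrightarrow>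
        dist p q \<le> dist p' q')"

definition hadamard_space :: "'a::metric_space set \<Rightarrow> bool" where
  "hadamard_space M \<longleftrightarrow> cat0_space M \<and> complete M"

definition geodesic_extension_property :: "'a::metric_space set \<Rightarrow> bool" where
  "geodesic_extension_property M \<longleftrightarrow>
     (\<forall>x y S. geodesic_segment M x y S \<longrightarrow>
        (\<exists>r. geodesic_ray M r \<and> r 0 = x \<and> (\<exists>t\<ge>0. r t = y)))"

text \<open>\<open>convex_combination M l x y\<close> is $(1-l)x + ly$; it is meaningful for \<open>0 \<le> l \<le> 1\<close>
  in spaces where geodesic segments are unique, such as CAT(0) spaces.\<close>

definition convex_combination :: "'a::metric_space set \<Rightarrow> real \<Rightarrow> 'a \<Rightarrow> 'a \<Rightarrow> 'a" where
  "convex_combination M l x y =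
     (THE z. \<exists>S. geodesic_segment M x y S \<and> z \<in> S \<and> dist x z = l * dist x y)"

definition max_dist :: "'a::metric_space set \<Rightarrow> 'a \<Rightarrow> real" where
  "max_dist A x = Max ((\<lambda>a. dist x a) ` A)"

definition circumcenter :: "'a::metric_space set \<Rightarrow> 'a set \<Rightarrow> 'a" where
  "circumcenter M A = (THE c. is_arg_min (max_dist A) (\<lambda>x. x \<in> M) c)"

definition circumradius :: "'a::metric_space set \<Rightarrow> 'a set \<Rightarrow> real" where
  "circumradius M A = max_dist A (circumcenter M A)"

text \<open>Computations that may fail and that count the elementary operations performed:
  \<open>Done v d c\<close> is a terminated computation with result \<open>v\<close> that used \<open>d\<close>
  distance computations and \<open>c\<close> convex combinations.\<close>

datatype 'b comp = Fail | Done 'b nat nat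

definition return :: "'b \<Rightarrow> 'b comp" where
  "return v = Done v 0 0"

definition bind_comp :: "'b comp \<Rightarrow> ('b \<Rightarrow> 'c comp) \<Rightarrow> 'c comp" where
  "bind_comp m f =
     (case m of Fail \<Rightarrow> Fail
      | Done v d c \<Rightarrow> (case f v of Fail \<Rightarrow> Fail | Done w d' c' \<Rightarrow> Done w (d + d') (c + c')))"

adhoc_overloading Monad_Syntax.bind \<rightleftharpoons> bind_comp

definition compute_dist :: "'a::metric_space \<Rightarrow> 'a \<Rightarrow> real comp" where
  "compute_dist a x = Done (dist a x) 1 0"

text \<open>The operation fails outside the range of weights for which a convex combination is
  defined, so a successful run certifies that all its convex combinations are legitimate.\<close>

definition compute_comb :: "'a::metric_space set \<Rightarrow> real \<Rightarrow> 'a \<Rightarrow> 'a \<Rightarrow> 'a comp" where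
  "compute_comb M l x y =
     (if 0 \<le> l \<and> l \<le> 1 then Done (convex_combination M l x y) 0 1 else Fail)"

primrec compute_dists :: "'a::metric_space \<Rightarrow> 'a list \<Rightarrow> real list comp" where
  "compute_dists x [] = return []"
| "compute_dists x (a # as) =
     do { d \<leftarrow> compute_dist a x; ds \<leftarrow> compute_dists x as; return (d # ds) }"

text \<open>The input set is presented as a list \<open>as\<close>, which fixes the order in which it is looped
  over. The state consists of the current point, the best point and the best value.\<close>

definition subgradient_step ::
    "'a::metric_space set \<Rightarrow> 'a list \<Rightarrow> real \<Rightarrow> 'a \<times> 'a \<times> real \<Rightarrow> ('a \<times> 'a \<times> real) comp" where
  "subgradient_step M as \<epsilon> = (\<lambda>(x, x_best, f_best).
     do {
       ds \<leftarrow> compute_dists x as;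
       let \<gamma> = Max (set ds);
       let a_hat = as ! (LEAST i. i < length as \<and> ds ! i = \<gamma>);
       let (x_best', f_best') = (if \<gamma> < f_best then (x, \<gamma>) else (x_best, f_best));
       let l = (if \<gamma> = 0 then 0 else \<epsilon> / \<gamma>);
       x' \<leftarrow> compute_comb M l x a_hat;
       return (x', x_best', f_best')
     })"

primrec repeat_comp :: "nat \<Rightarrow> ('s \<Rightarrow> 's comp) \<Rightarrow> 's \<Rightarrow> 's comp" where
  "repeat_comp 0 f s = return s"
| "repeat_comp (Suc m) f s = do { s' \<leftarrow> f s; repeat_comp m f s' }"

definition circumcenter_subgradient ::
    "'a::metric_space set \<Rightarrow> 'a list \<Rightarrow> 'a \<Rightarrow> nat \<Rightarrow> 'a comp" where
  "circumcenter_subgradient M as x n =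
     do {
       ds \<leftarrow> compute_dists x (filter (\<lambda>a. a \<noteq> x) as);
       let \<rho> = (if ds = [] then 0 else Max (set ds));
       let \<epsilon> = 2 * \<rho> / sqrt (real n);
       (_, x_best, _) \<leftarrow> repeat_comp n (subgradient_step M as \<epsilon>) (x, x, \<rho>);
       return x_best
     }"

end

theory Submission
  imports Defs
begin

text \<open>
  The algorithm is a subgradient method with constant step length \<open>\<epsilon>\<close>, and its analysis
  follows the squared distance from the iterate to the circumcenter \<open>c\<close>. Write \<open>r\<close> for
  the circumradius. Comparison with the Euclidean plane bounds the squared distance from a fixed
  point along a geodesic (\<open>cat0_sq_dist_le\<close>). Applied to the move of length \<open>\<epsilon>\<close> from
  the iterate \<open>x\<close> towards a farthest point of \<open>A\<close>, at distance \<open>\<gamma>\<close>, it says that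
  the squared distance to \<open>c\<close> changes by at most \<open>\<epsilon>\<^sup>2 - 2 \<epsilon> (\<gamma> - r)\<close>
  (\<open>sq_dist_step_le\<close>). Squared distances stay nonnegative, so over \<open>n\<close> steps the average
  of \<open>\<gamma> - r\<close>, and with it the smallest value, is at most
  \<open>(d(x\<^sub>0,c)\<^sup>2 + n \<epsilon>\<^sup>2) / (2 n \<epsilon>)\<close>. The initial point lies in \<open>A\<close>, so
  \<open>d(x\<^sub>0,c) \<le> r \<le> \<rho>\<close>, and for \<open>\<epsilon> = 2 \<rho> / \<surd>n\<close> the bound becomes
  \<open>5 \<rho> / (4 \<surd>n)\<close>, which is at most \<open>2 \<mu> / \<surd>n\<close> because \<open>\<rho> \<le> \<mu>\<close>.
  This needs \<open>\<rho> > 0\<close>; if \<open>\<rho> = 0\<close>, the best value is \<open>0\<close> from the start.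

  The weights \<open>\<epsilon> / \<gamma>\<close> are at most 1: two points of \<open>A\<close> are at distance
  \<open>\<rho>\<close> from each other, hence \<open>\<gamma> \<ge> \<rho> / 2\<close> at every point, while \<open>n \<ge> 16\<close>
  gives \<open>\<epsilon> \<le> \<rho> / 2\<close>.

  The circumcenter exists and is unique because the same comparison inequality makes the squared
  maximal distance uniformly convex: minimizing sequences are Cauchy, and they converge by
  completeness (\<open>ex1_circumcenter\<close>).
\<close>

section \<open>Geodesic segments and Euclidean comparison\<close>

lemma geodesic_segment_subset: "geodesic_segment M x y S \<Longrightarrow> S \<subseteq> M"
  by (auto simp: geodesic_segment_def)

lemma geodesic_segment_endpoints:
  fixes x y :: "'a::metric_space"
  assumes "geodesic_segment M x y S"
  shows "x \<in> S" and "y \<in> S"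
proof -
  obtain c :: "real \<Rightarrow> 'a" and l where "0 \<le> l" "c 0 = x" "c l = y" "S = c ` {0..l}"
    using assms unfolding geodesic_segment_def by blast
  then show "x \<in> S" and "y \<in> S"
    by (auto intro: image_eqI[of _ _ 0] image_eqI[of _ _ l])
qed

lemma geodesic_segment_dist_add:
  assumes "geodesic_segment M x y S" and "z \<in> S"
  shows "dist x z + dist z y = dist x y"
proof -
  obtain c l where c: "0 \<le> l" "c 0 = x" "c l = y" "S = c ` {0..l}"
    and iso: "\<forall>s\<in>{0..l}. \<forall>t\<in>{0..l}. dist (c s) (c t) = \<bar>s - t\<bar>"
    using assms(1) unfolding geodesic_segment_def by blast
  obtain t where t: "t \<in> {0..l}" "z = c t" using assms(2) c by blast
  have "dist x z = t" "dist z y = l - t" "dist x y = l"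
    using iso[rule_format, of 0 t] iso[rule_format, of t l] iso[rule_format, of 0 l] t c by auto
  then show ?thesis by simp
qed

lemma geodesic_segment_ex_point:
  assumes "geodesic_segment M x y S" and "0 \<le> l" "l \<le> 1"
  shows "\<exists>z\<in>S. dist x z = l * dist x y"
proof -
  obtain c L where c: "0 \<le> L" "c 0 = x" "c L = y" "S = c ` {0..L}"
    and iso: "\<forall>s\<in>{0..L}. \<forall>t\<in>{0..L}. dist (c s) (c t) = \<bar>s - t\<bar>"
    using assms(1) unfolding geodesic_segment_def by blast
  have m: "l * L \<in> {0..L}" using assms c(1) by (auto simp: mult_left_le_one_le)
  have "dist x y = L" using iso[rule_format, of 0 L] c by auto
  moreover have "dist x (c (l * L)) = l * L" using iso[rule_format, of 0 "l * L"] m c by auto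
  ultimately show ?thesis using m c(4) by auto
qed

lemma ex_comparison_triangle:
  fixes x y z :: "'a::metric_space"
  shows "\<exists>x' y' z'. comparison_triangle x y z x' y' z'"
proof (cases "x = y")
  case True
  have "comparison_triangle x y z 0 0 (vector [dist x z, 0] :: real^2)"
    using True
    by (simp add: comparison_triangle_def dist_vec_def L2_set_def sum_2 dist_commute)
  then show ?thesis by blast
next
  case False
  define a b c where "a = dist x y" and "b = dist x z" and "c = dist y z"
  have pos: "a > 0" "b \<ge> 0" "c \<ge> 0" using False by (auto simp: a_def b_def c_def)
  have tri: "a \<le> b + c" "b \<le> a + c" "c \<le> a + b"
    unfolding a_def b_def c_def by metric+
  \<comment> \<open>With \<open>x'\<close> at the origin and \<open>y'\<close> on the first axis, the law of cosines gives the
    first coordinate \<open>u\<close> of \<open>z'\<close>.\<close>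
  define u where "u = (a\<^sup>2 + b\<^sup>2 - c\<^sup>2) / (2 * a)"
  have au: "2 * a * u = a\<^sup>2 + b\<^sup>2 - c\<^sup>2" using pos by (simp add: u_def)
  have "\<bar>u\<bar> \<le> b"
  proof -
    have "c\<^sup>2 \<le> (a + b)\<^sup>2" "(a - b)\<^sup>2 \<le> c\<^sup>2"
      using tri pos by (auto intro!: power_mono simp: abs_le_square_iff[symmetric])
    then have "2 * a * u \<le> 2 * a * b" "2 * a * (- b) \<le> 2 * a * u"
      using au by (auto simp: power2_eq_square algebra_simps)
    then have "u \<le> b" "- b \<le> u"
      using pos by (metis mult_le_cancel_left_pos mult_pos_pos zero_less_numeral)+
    then show ?thesis by simp
  qed
  then have ub: "u\<^sup>2 \<le> b\<^sup>2" using pos by (simp add: abs_le_square_iff[symmetric])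
  define v where "v = sqrt (b\<^sup>2 - u\<^sup>2)"
  have v: "v\<^sup>2 = b\<^sup>2 - u\<^sup>2" using ub by (simp add: v_def)
  have "(a - u)\<^sup>2 + v\<^sup>2 = c\<^sup>2" using v au by (simp add: power2_eq_square algebra_simps)
  moreover have "u\<^sup>2 + v\<^sup>2 = b\<^sup>2" using v by simp
  ultimately have "comparison_triangle x y z 0 (vector [a, 0] :: real^2) (vector [u, v])"
    using pos
    by (simp add: comparison_triangle_def dist_vec_def L2_set_def sum_2 dist_real_def
        a_def b_def c_def dist_commute)
  then show ?thesis by blast
qed

text \<open>In an inner product space this is an identity (Stewart's theorem), and in a CAT(0) space
  the comparison triangle turns it into an upper bound.\<close>

lemma cat0_sq_dist_le:
  assumes cat: "cat0_space M" and seg: "geodesic_segment M x y S"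
    and z: "z \<in> S" "dist x z = l * dist x y" and l: "0 \<le> l" "l \<le> 1" and p: "p \<in> M"
  shows "(dist p z)\<^sup>2 \<le> (1 - l) * (dist p x)\<^sup>2 + l * (dist p y)\<^sup>2 - l * (1 - l) * (dist x y)\<^sup>2"
proof -
  have xy: "x \<in> M" "y \<in> M"
    using geodesic_segment_endpoints[OF seg] geodesic_segment_subset[OF seg] by auto
  obtain Syp Sxp where segs: "geodesic_segment M y p Syp" "geodesic_segment M x p Sxp"
    using cat xy p unfolding cat0_space_def by meson
  obtain x' y' p' where tri: "comparison_triangle x y p x' y' p'"
    using ex_comparison_triangle by blast
  define z' where "z' = (1 - l) *\<^sub>R x' + l *\<^sub>R y'"
  have "x' - z' = l *\<^sub>R (x' - y')" by (simp add: z'_def algebra_simps)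
  then have "dist x' z' = dist x z"
    using tri z(2) l by (simp add: dist_norm comparison_triangle_def)
  then have cz: "comparison_point x z x' y' z'"
    using l by (auto simp: comparison_point_def closed_segment_def z'_def)
  have cp: "comparison_point x p x' p' p'"
    using tri by (auto simp: comparison_point_def comparison_triangle_def dist_commute)
  have "dist z p \<le> dist z' p'"
    using cat segs seg tri cz cp z(1) geodesic_segment_endpoints(2)[OF segs(2)]
    unfolding cat0_space_def by blast
  then have "(dist p z)\<^sup>2 \<le> (dist p' z')\<^sup>2"
    by (simp add: dist_commute power_mono)
  also have "(dist p' z')\<^sup>2 =
      (1 - l) * (dist p' x')\<^sup>2 + l * (dist p' y')\<^sup>2 - l * (1 - l) * (dist x' y')\<^sup>2"
    unfolding dist_norm power2_norm_eq_inner z'_def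
    by (simp add: inner_simps inner_commute algebra_simps power2_eq_square)
  finally show ?thesis
    using tri by (simp add: comparison_triangle_def dist_commute)
qed

text \<open>Two candidates for the convex combination coincide: the comparison inequality for one of
  them, seen from the other, bounds their squared distance by
  \<open>(1 - l) (l D)\<^sup>2 + l ((1 - l) D)\<^sup>2 - l (1 - l) D\<^sup>2 = 0\<close>, where \<open>D = d(x,y)\<close>.\<close>

lemma convex_combination_on_segment:
  assumes cat: "cat0_space M" and xy: "x \<in> M" "y \<in> M" and l: "0 \<le> l" "l \<le> 1"
  shows "\<exists>S. geodesic_segment M x y S \<and> convex_combination M l x y \<in> S \<and>
           dist x (convex_combination M l x y) = l * dist x y"
  unfolding convex_combination_def
proof (rule theI')
  let ?P = "\<lambda>z. \<exists>S. geodesic_segment M x y S \<and> z \<in> S \<and> dist x z = l * dist x y"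
  show "\<exists>!z. ?P z"
  proof (rule ex_ex1I)
    obtain S where "geodesic_segment M x y S" using cat xy unfolding cat0_space_def by blast
    then show "\<exists>z. ?P z" using geodesic_segment_ex_point l by blast
  next
    fix z w assume "?P z" "?P w"
    then obtain S T where S: "geodesic_segment M x y S" "z \<in> S" "dist x z = l * dist x y"
      and T: "geodesic_segment M x y T" "w \<in> T" "dist x w = l * dist x y" by blast
    have wx: "dist w x = l * dist x y" using T(3) by (simp add: dist_commute)
    have wy: "dist w y = (1 - l) * dist x y"
      using geodesic_segment_dist_add[OF T(1,2)] T(3) by (simp add: algebra_simps)
    have "w \<in> M" using T geodesic_segment_subset by blast
    from cat0_sq_dist_le[OF cat S l this] have "(dist w z)\<^sup>2 \<le> 0"
      unfolding wx wy by (simp add: power2_eq_square algebra_simps)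
    then show "z = w" by simp
  qed
qed

lemma convex_combination_in:
  assumes "cat0_space M" and "x \<in> M" "y \<in> M" and "0 \<le> l" "l \<le> 1"
  shows "convex_combination M l x y \<in> M"
  using convex_combination_on_segment[OF assms] geodesic_segment_subset by blast

lemma sq_dist_convex_combination_le:
  assumes "cat0_space M" and "x \<in> M" "y \<in> M" and "0 \<le> l" "l \<le> 1" and "p \<in> M"
  shows "(dist p (convex_combination M l x y))\<^sup>2
    \<le> (1 - l) * (dist p x)\<^sup>2 + l * (dist p y)\<^sup>2 - l * (1 - l) * (dist x y)\<^sup>2"
proof -
  obtain S where "geodesic_segment M x y S" "convex_combination M l x y \<in> S"
    "dist x (convex_combination M l x y) = l * dist x y"
    using convex_combination_on_segment[OF assms(1-5)] by blast
  from cat0_sq_dist_le[OF assms(1) this assms(4-6)] show ?thesis .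
qed

section \<open>The circumcenter of a finite set\<close>

lemma dist_le_max_dist: "finite A \<Longrightarrow> a \<in> A \<Longrightarrow> dist x a \<le> max_dist A x"
  by (auto simp: max_dist_def)

lemma max_dist_attained:
  assumes "finite A" "A \<noteq> {}"
  obtains a where "a \<in> A" "max_dist A x = dist x a"
  using Max_in[of "(\<lambda>a. dist x a) ` A"] assms that unfolding max_dist_def by blast

lemma max_dist_nonneg: "finite A \<Longrightarrow> A \<noteq> {} \<Longrightarrow> 0 \<le> max_dist A x"
  by (rule max_dist_attained[of A x]) auto

lemma max_dist_le_add_dist:
  assumes "finite A" "A \<noteq> {}"
  shows "max_dist A x \<le> max_dist A y + dist x y"
proof -
  obtain a where a: "a \<in> A" "max_dist A x = dist x a" using max_dist_attained[OF assms] .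
  have "dist x a \<le> dist x y + dist y a" by (rule dist_triangle)
  then show ?thesis using a dist_le_max_dist[OF assms(1) a(1), of y] by simp
qed

lemma max_dist_midpoint_le:
  assumes cat: "cat0_space M" and A: "finite A" "A \<noteq> {}" "A \<subseteq> M" and xy: "x \<in> M" "y \<in> M"
  shows "(max_dist A (convex_combination M (1/2) x y))\<^sup>2
    \<le> ((max_dist A x)\<^sup>2 + (max_dist A y)\<^sup>2) / 2 - (dist x y)\<^sup>2 / 4"
proof -
  let ?m = "convex_combination M (1/2) x y"
  obtain a where a: "a \<in> A" "max_dist A ?m = dist ?m a" using max_dist_attained[OF A(1,2)] .
  have "(dist x a)\<^sup>2 \<le> (max_dist A x)\<^sup>2" "(dist y a)\<^sup>2 \<le> (max_dist A y)\<^sup>2"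
    using dist_le_max_dist[OF A(1) a(1)] by (auto intro: power_mono)
  moreover have "(dist a ?m)\<^sup>2 \<le> ((dist a x)\<^sup>2 + (dist a y)\<^sup>2) / 2 - (dist x y)\<^sup>2 / 4"
    using sq_dist_convex_combination_le[OF cat xy, of "1/2" a] a(1) A(3)
    by (auto simp: field_simps)
  ultimately show ?thesis unfolding a(2) by (simp add: dist_commute field_simps)
qed

text \<open>Midpoint convexity controls the distance between two near-minimizers: the maximal distance
  at their midpoint is at least the infimum, hence the term \<open>d(x,y)\<^sup>2 / 4\<close> is at most the
  average excess of the two squared values.\<close>

lemma ex1_circumcenter:
  assumes had: "hadamard_space M" and A: "finite A" "A \<noteq> {}" "A \<subseteq> M"
  shows "\<exists>!c. is_arg_min (max_dist A) (\<lambda>x. x \<in> M) c"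
proof -
  have cat: "cat0_space M" and compl: "complete M" using had by (auto simp: hadamard_space_def)
  let ?f = "max_dist A"
  define s where "s = (INF x\<in>M. (?f x)\<^sup>2)"
  have ne: "M \<noteq> {}" using A by auto
  have bdd: "bdd_below ((\<lambda>x. (?f x)\<^sup>2) ` M)" by (rule bdd_belowI[of _ 0]) auto
  have s_le: "s \<le> (?f x)\<^sup>2" if "x \<in> M" for x
    unfolding s_def using bdd that by (rule cINF_lower)
  have close: "(dist x y)\<^sup>2 \<le> 2 * ((?f x)\<^sup>2 - s) + 2 * ((?f y)\<^sup>2 - s)"
    if "x \<in> M" "y \<in> M" for x y
    using s_le[OF convex_combination_in[OF cat that, of "1/2"]]
      max_dist_midpoint_le[OF cat A that] by (simp add: field_simps)
  have "\<exists>x\<in>M. (?f x)\<^sup>2 < s + e" if "e > 0" for e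
    using cINF_less_iff[OF ne bdd, of "s + e"] that unfolding s_def by simp
  then have "\<exists>x\<in>M. (?f x)\<^sup>2 < s + 1 / real (Suc i)" for i by simp
  then obtain X where X: "X i \<in> M" "(?f (X i))\<^sup>2 < s + 1 / real (Suc i)" for i by metis
  have "Cauchy X"
  proof (rule metric_CauchyI)
    fix e :: real assume e: "e > 0"
    then obtain N where N: "4 / real (Suc N) < e\<^sup>2"
      using reals_Archimedean[of "e\<^sup>2 / 4"] by (auto simp: field_simps)
    have "dist (X i) (X j) < e" if "N \<le> i" "N \<le> j" for i j
    proof -
      have "1 / real (Suc i) \<le> 1 / real (Suc N)" "1 / real (Suc j) \<le> 1 / real (Suc N)"
        using that by (auto simp: frac_le)
      then have "(dist (X i) (X j))\<^sup>2 < e\<^sup>2"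
        using close[OF X(1) X(1), of i j] X(2)[of i] X(2)[of j] N by simp
      then show ?thesis using e by (simp add: power2_less_imp_less)
    qed
    then show "\<exists>N. \<forall>i\<ge>N. \<forall>j\<ge>N. dist (X i) (X j) < e" by blast
  qed
  then obtain c where c: "c \<in> M" "X \<longlonglongrightarrow> c" using compl X(1) unfolding complete_def by blast
  have "(\<lambda>i. ?f (X i)) \<longlonglongrightarrow> ?f c"
  proof (rule metric_tendsto_imp_tendsto[OF c(2)], intro always_eventually allI)
    fix i show "dist (?f (X i)) (?f c) \<le> dist (X i) c"
      using max_dist_le_add_dist[OF A(1,2), of "X i" c] max_dist_le_add_dist[OF A(1,2), of c "X i"]
      by (simp add: dist_real_def dist_commute abs_le_iff)
  qed
  then have 1: "(\<lambda>i. (?f (X i))\<^sup>2) \<longlonglongrightarrow> (?f c)\<^sup>2" by (rule tendsto_power)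
  have 2: "(\<lambda>i. s + 1 / real (Suc i)) \<longlonglongrightarrow> s"
    using tendsto_add[OF tendsto_const LIMSEQ_inverse_real_of_nat, of s] by (simp add: inverse_eq_divide)
  have fc: "(?f c)\<^sup>2 \<le> s"
    by (rule LIMSEQ_le[OF 1 2]) (use X(2) less_imp_le in blast)
  have min: "?f c \<le> ?f x" if "x \<in> M" for x
    using s_le[OF that] fc max_dist_nonneg[OF A(1,2)] by (meson order_trans power2_le_imp_le)
  show ?thesis
  proof (rule ex1I)
    show "is_arg_min ?f (\<lambda>x. x \<in> M) c" using c min by (auto simp: is_arg_min_linorder)
  next
    fix y assume "is_arg_min ?f (\<lambda>x. x \<in> M) y"
    then have y: "y \<in> M" "?f y \<le> ?f c" using c by (auto simp: is_arg_min_linorder)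
    then have "(?f y)\<^sup>2 \<le> s"
      using fc max_dist_nonneg[OF A(1,2)] by (meson order_trans power_mono)
    then have "2 * ((?f y)\<^sup>2 - s) + 2 * ((?f c)\<^sup>2 - s) \<le> 0" using fc by simp
    then have "(dist y c)\<^sup>2 \<le> 0" by (rule order_trans[OF close[OF y(1) c(1)]])
    then show "y = c" by simp
  qed
qed

lemma circumcenter_minimizes:
  assumes "hadamard_space M" and "finite A" "A \<noteq> {}" "A \<subseteq> M"
  shows "circumcenter M A \<in> M" and "\<And>x. x \<in> M \<Longrightarrow> circumradius M A \<le> max_dist A x"
proof -
  have "is_arg_min (max_dist A) (\<lambda>x. x \<in> M) (circumcenter M A)"
    unfolding circumcenter_def using ex1_circumcenter[OF assms] by (rule theI')
  then show "circumcenter M A \<in> M" and "\<And>x. x \<in> M \<Longrightarrow> circumradius M A \<le> max_dist A x"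
    by (auto simp: is_arg_min_linorder circumradius_def)
qed

lemma dist_circumcenter_le:
  "finite A \<Longrightarrow> a \<in> A \<Longrightarrow> dist (circumcenter M A) a \<le> circumradius M A"
  unfolding circumradius_def by (rule dist_le_max_dist)

section \<open>Progress of a single step\<close>

text \<open>With \<open>\<epsilon> = l \<gamma>\<close>, where \<open>\<gamma> = d(x,a)\<close> and \<open>D = d(x,p)\<close>, the comparison
  inequality bounds the new squared distance by \<open>D\<^sup>2 + \<epsilon>\<^sup>2 - l (\<gamma>\<^sup>2 + D\<^sup>2 - r\<^sup>2)\<close>.
  The triangle inequality gives \<open>\<gamma> - r \<le> D\<close>, so \<open>\<gamma>\<^sup>2 + D\<^sup>2 - r\<^sup>2\<close> is at least
  \<open>2 \<gamma> (\<gamma> - r)\<close> as soon as \<open>\<gamma> \<ge> r\<close>.\<close>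

lemma sq_dist_step_le:
  assumes cat: "cat0_space M" and M: "x \<in> M" "a \<in> M" "p \<in> M" and l: "0 \<le> l" "l \<le> 1"
    and far: "dist p a \<le> r" "r \<le> dist x a"
  shows "(dist (convex_combination M l x a) p)\<^sup>2
    \<le> (dist x p)\<^sup>2 + (l * dist x a)\<^sup>2 - 2 * (l * dist x a) * (dist x a - r)"
proof -
  define g D where "g = dist x a" and "D = dist x p"
  have "g - r \<le> D" using far(1) dist_triangle[of x a p] by (simp add: g_def D_def)
  then have "(g - r)\<^sup>2 \<le> D\<^sup>2" using far(2) by (intro power_mono) (auto simp: g_def)
  then have "2 * g * (g - r) \<le> g\<^sup>2 + D\<^sup>2 - r\<^sup>2" by (simp add: power2_eq_square algebra_simps)
  then have key: "l * (2 * g * (g - r)) \<le> l * (g\<^sup>2 + D\<^sup>2 - r\<^sup>2)"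
    using l by (intro mult_left_mono)
  have "(dist p a)\<^sup>2 \<le> r\<^sup>2" using far by (intro power_mono) auto
  then have "l * (dist p a)\<^sup>2 \<le> l * r\<^sup>2" using l by (intro mult_left_mono)
  with sq_dist_convex_combination_le[OF cat M(1,2) l M(3)]
  have "(dist (convex_combination M l x a) p)\<^sup>2 \<le> (1 - l) * D\<^sup>2 + l * r\<^sup>2 - l * (1 - l) * g\<^sup>2"
    unfolding g_def D_def by (simp add: dist_commute)
  with key show ?thesis
    unfolding g_def[symmetric] D_def[symmetric] by (simp add: power2_eq_square algebra_simps)
qed

section \<open>Executing the algorithm\<close>

lemma bind_comp_Done [simp]:
  "bind_comp (Done v d c) f =
     (case f v of Fail \<Rightarrow> Fail | Done w d' c' \<Rightarrow> Done w (d + d') (c + c'))"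
  by (simp add: bind_comp_def)

lemma compute_dists_eq:
  "compute_dists x xs = Done (map (\<lambda>a. dist a x) xs) (length xs) 0"
  by (induction xs) (auto simp: return_def compute_dist_def)

lemma Max_map_dist: "Max (set (map (\<lambda>a. dist a x) xs)) = max_dist (set xs) x"
  by (simp add: max_dist_def dist_commute)

text \<open>Leaving out \<open>x\<close> saves one distance computation and drops only the value
  \<open>d(x,x) = 0\<close>, which the default value for the empty list restores where it matters.\<close>

lemma max_dist_filter_neq:
  assumes "x \<in> set xs"
  shows "(if filter (\<lambda>a. a \<noteq> x) xs = [] then 0
          else Max (set (map (\<lambda>a. dist a x) (filter (\<lambda>a. a \<noteq> x) xs)))) = max_dist (set xs) x"
proof -
  let ?B = "set (filter (\<lambda>a. a \<noteq> x) xs)"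
  have ins: "set xs = insert x ?B" using assms by auto
  show ?thesis
  proof (cases "?B = {}")
    case True
    then show ?thesis unfolding ins by (simp add: max_dist_def)
  next
    case False
    then have "max_dist (set xs) x = max 0 (max_dist ?B x)"
      unfolding ins max_dist_def by (subst image_insert, subst Max_insert) auto
    also have "\<dots> = max_dist ?B x" using max_dist_nonneg[OF _ False] by simp
    finally have "max_dist (set xs) x = max_dist ?B x" .
    moreover have "filter (\<lambda>a. a \<noteq> x) xs \<noteq> []" using False by force
    ultimately show ?thesis unfolding Max_map_dist by simp
  qed
qed

lemma subgradient_step_eq:
  assumes "xs \<noteq> []"
    and l_def: "l = (if max_dist (set xs) x = 0 then 0 else \<epsilon> / max_dist (set xs) x)"
    and l: "0 \<le> l" "l \<le> 1"
  obtains a where "a \<in> set xs" "dist x a = max_dist (set xs) x"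
    "subgradient_step M xs \<epsilon> (x, xb, fb) =
       Done (convex_combination M l x a,
             if max_dist (set xs) x < fb then x else xb,
             min (max_dist (set xs) x) fb) (length xs) 1"
proof -
  let ?g = "max_dist (set xs) x"
  define i where "i = (LEAST i. i < length xs \<and> map (\<lambda>a. dist a x) xs ! i = ?g)"
  obtain b where "b \<in> set xs" "?g = dist x b" using max_dist_attained[of "set xs" x] assms(1) by auto
  then have "\<exists>j. j < length xs \<and> map (\<lambda>a. dist a x) xs ! j = ?g"
    by (auto simp: in_set_conv_nth dist_commute)
  then have i: "i < length xs" "map (\<lambda>a. dist a x) xs ! i = ?g"
    unfolding i_def by (metis (mono_tags, lifting) LeastI_ex)+
  show ?thesis
  proof (rule that)
    show "xs ! i \<in> set xs" "dist x (xs ! i) = ?g" using i by (auto simp: dist_commute)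
    show "subgradient_step M xs \<epsilon> (x, xb, fb) =
        Done (convex_combination M l x (xs ! i), if ?g < fb then x else xb, min ?g fb) (length xs) 1"
      unfolding subgradient_step_def prod.case compute_dists_eq bind_comp_Done Max_map_dist Let_def
        i_def[symmetric] l_def[symmetric] compute_comb_def
      using l by (simp add: return_def)
  qed
qed

text \<open>The number of completed steps is an argument of the invariant, since the estimate to be
  maintained improves with it.\<close>

lemma repeat_comp_invariant:
  assumes "I j s"
    and step: "\<And>j s. I j s \<Longrightarrow> \<exists>s'. f s = Done s' d c \<and> I (Suc j) s'"
  shows "\<exists>s'. repeat_comp m f s = Done s' (m * d) (m * c) \<and> I (j + m) s'"
  using assms(1)
proof (induction m arbitrary: j s)
  case 0
  then show ?case by (simp add: return_def)
next
  case (Suc m)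
  obtain s' where s': "f s = Done s' d c" "I (Suc j) s'" using step[OF Suc.prems] by blast
  show ?case using Suc.IH[OF s'(2)] s'(1) by auto
qed

section \<open>The accuracy of the algorithm\<close>

text \<open>Telescoping \<open>sq_dist_step_le\<close>: as \<open>fb\<close> is the smallest value seen so far, each of
  the \<open>j\<close> steps has lowered the squared distance to the circumcenter by at least
  \<open>2 \<epsilon> (fb - r) - \<epsilon>\<^sup>2\<close>. The upper bound on \<open>\<epsilon>\<close> keeps the weights at most 1; the
  inequalities are weak so as to admit singletons, where \<open>\<epsilon> = 0\<close> and the maximal distance
  can vanish.\<close>

lemma repeat_subgradient_step:
  fixes M :: "'a::metric_space set" and xs :: "'a list"
  defines "r \<equiv> circumradius M (set xs)" and "c \<equiv> circumcenter M (set xs)"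
  assumes had: "hadamard_space M" and xs: "xs \<noteq> []" "set xs \<subseteq> M" and x0: "x\<^sub>0 \<in> M"
    and eps: "0 \<le> \<epsilon>" "\<And>y. \<epsilon> \<le> max_dist (set xs) y"
  shows "\<exists>x xb. repeat_comp n (subgradient_step M xs \<epsilon>) (x\<^sub>0, x\<^sub>0, max_dist (set xs) x\<^sub>0) =
             Done (x, xb, max_dist (set xs) xb) (n * length xs) n \<and>
           xb \<in> M \<and> max_dist (set xs) xb \<le> max_dist (set xs) x\<^sub>0 \<and>
           real n * (2 * \<epsilon> * (max_dist (set xs) xb - r)) \<le> (dist x\<^sub>0 c)\<^sup>2 + real n * \<epsilon>\<^sup>2"
proof -
  let ?A = "set xs"
  have cat: "cat0_space M" using had by (simp add: hadamard_space_def)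
  have A: "finite ?A" "?A \<noteq> {}" "?A \<subseteq> M" using xs by auto
  have c: "c \<in> M" unfolding c_def by (rule circumcenter_minimizes[OF had A])
  define I where "I = (\<lambda>j (x, xb, fb). x \<in> M \<and> xb \<in> M \<and> fb = max_dist ?A xb \<and>
      fb \<le> max_dist ?A x\<^sub>0 \<and>
      (dist x c)\<^sup>2 + real j * (2 * \<epsilon> * (fb - r)) \<le> (dist x\<^sub>0 c)\<^sup>2 + real j * \<epsilon>\<^sup>2)"
  have step: "\<exists>s'. subgradient_step M xs \<epsilon> s = Done s' (length xs) 1 \<and> I (Suc j) s'"
    if "I j s" for j s
  proof -
    obtain x xb fb where s: "s = (x, xb, fb)" by (cases s)
    have inv: "x \<in> M" "xb \<in> M" "fb = max_dist ?A xb" "fb \<le> max_dist ?A x\<^sub>0"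
      "(dist x c)\<^sup>2 + real j * (2 * \<epsilon> * (fb - r)) \<le> (dist x\<^sub>0 c)\<^sup>2 + real j * \<epsilon>\<^sup>2"
      using that by (auto simp: I_def s)
    define g where "g = max_dist ?A x"
    define l where "l = (if g = 0 then 0 else \<epsilon> / g)"
    have g: "0 \<le> g" "\<epsilon> \<le> g" using max_dist_nonneg[OF A(1,2)] eps by (auto simp: g_def)
    have l: "0 \<le> l" "l \<le> 1" "l * g = \<epsilon>" using g eps(1) by (auto simp: l_def)
    obtain a where a: "a \<in> ?A" "dist x a = g"
      and eq: "subgradient_step M xs \<epsilon> (x, xb, fb) =
        Done (convex_combination M l x a, if g < fb then x else xb, min g fb) (length xs) 1"
      using subgradient_step_eq[OF xs(1), of l x \<epsilon> M xb fb] l unfolding l_def g_def by auto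
    have aM: "a \<in> M" using a A by auto
    have "dist c a \<le> r" unfolding r_def c_def using a A(1) by (intro dist_circumcenter_le)
    moreover have "r \<le> dist x a"
      unfolding a(2) g_def r_def using circumcenter_minimizes[OF had A] inv(1) by blast
    ultimately have dec: "(dist (convex_combination M l x a) c)\<^sup>2
        \<le> (dist x c)\<^sup>2 + \<epsilon>\<^sup>2 - 2 * \<epsilon> * (g - r)"
      using sq_dist_step_le[OF cat inv(1) aM c l(1,2)] a(2) l(3) by simp
    have "2 * \<epsilon> * (min g fb - r) \<le> 2 * \<epsilon> * (g - r)"
      "real j * (2 * \<epsilon> * (min g fb - r)) \<le> real j * (2 * \<epsilon> * (fb - r))"
      using eps(1) by (auto intro!: mult_left_mono)
    then have "I (Suc j) (convex_combination M l x a, if g < fb then x else xb, min g fb)"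
      using inv dec convex_combination_in[OF cat inv(1) aM l(1,2)]
      by (auto simp: I_def g_def algebra_simps)
    then show ?thesis using eq s by blast
  qed
  have "I 0 (x\<^sub>0, x\<^sub>0, max_dist ?A x\<^sub>0)" using x0 by (simp add: I_def)
  then obtain s where rep: "repeat_comp n (subgradient_step M xs \<epsilon>) (x\<^sub>0, x\<^sub>0, max_dist ?A x\<^sub>0)
        = Done s (n * length xs) (n * 1)" and I: "I (0 + n) s"
    using repeat_comp_invariant[where I = I and f = "subgradient_step M xs \<epsilon>", OF _ step]
    by blast
  obtain x xb fb where s: "s = (x, xb, fb)" by (cases s)
  have inv: "xb \<in> M" "fb = max_dist ?A xb" "fb \<le> max_dist ?A x\<^sub>0"
    "(dist x c)\<^sup>2 + real n * (2 * \<epsilon> * (fb - r)) \<le> (dist x\<^sub>0 c)\<^sup>2 + real n * \<epsilon>\<^sup>2"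
    using I by (auto simp: I_def s)
  have "real n * (2 * \<epsilon> * (fb - r)) \<le> (dist x\<^sub>0 c)\<^sup>2 + real n * \<epsilon>\<^sup>2"
    using inv(4) zero_le_power2[of "dist x c"] by linarith
  then show ?thesis using rep inv s by auto
qed

text \<open>Both \<open>x\<close> and the point of \<open>A\<close> farthest from it are within \<open>max_dist A y\<close> of
  \<open>y\<close>. This is the bound \<open>\<gamma> \<ge> \<rho> / 2\<close> behind the weights.\<close>

lemma max_dist_le_twice_max_dist:
  assumes "finite A" "x \<in> A"
  shows "max_dist A x \<le> 2 * max_dist A y"
proof -
  have "A \<noteq> {}" using assms by auto
  from max_dist_le_add_dist[OF assms(1) this, of x y] show ?thesis
    using dist_le_max_dist[OF assms, of y] by (simp add: dist_commute)
qed

theorem corollary7p4: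
  fixes M A :: "'a::metric_space set" and as :: "'a list" and x\<^sub>0 :: 'a
    and k n :: nat and \<mu> :: real
  assumes "hadamard_space M" and "geodesic_extension_property M"
    and "A \<subseteq> M" and "finite A" and "card A = k" and "k > 0" and "diameter A = \<mu>"
    and "n \<ge> 16"
    and "distinct as" and "set as = A" and "x\<^sub>0 \<in> A"
  shows "\<exists>x_best. circumcenter_subgradient M as x\<^sub>0 n = Done x_best (k * (n + 1) - 1) n \<and>
           x_best \<in> M \<and>
           (\<forall>a\<in>A. dist x_best a \<le> circumradius M A + 2 * \<mu> / sqrt (real n))"
proof -
  let ?r = "circumradius M A" and ?c = "circumcenter M A"
  have ne: "A \<noteq> {}" using assms by auto
  have x0: "x\<^sub>0 \<in> M" using assms by auto
  have len: "length as = k" using assms distinct_card by metis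
  have len': "length (filter (\<lambda>a. a \<noteq> x\<^sub>0) as) = k - 1"
  proof -
    have "set (filter (\<lambda>a. a \<noteq> x\<^sub>0) as) = A - {x\<^sub>0}" using assms by auto
    then show ?thesis
      using assms distinct_card[OF distinct_filter[OF \<open>distinct as\<close>], of "\<lambda>a. a \<noteq> x\<^sub>0"] by simp
  qed
  define \<rho> s where "\<rho> = max_dist A x\<^sub>0" and "s = sqrt (real n)"
  have s4: "4 \<le> s" using assms(8) real_le_rsqrt[of 4 "real n"] by (simp add: s_def)
  have s2: "s\<^sup>2 = real n" by (simp add: s_def)
  define \<epsilon> where "\<epsilon> = 2 * \<rho> / s"
  have \<rho>0: "0 \<le> \<rho>" using max_dist_nonneg[OF assms(4) ne] by (simp add: \<rho>_def)
  have "2 * \<rho> / s \<le> 2 * \<rho> / 4" using s4 \<rho>0 by (intro divide_left_mono) auto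
  then have eps: "0 \<le> \<epsilon>" "\<epsilon> \<le> max_dist (set as) y" for y
    using max_dist_le_twice_max_dist[OF assms(4,11), of y] assms(10) s4 \<rho>0
    by (auto simp: \<epsilon>_def \<rho>_def)
  obtain x xb where rep: "repeat_comp n (subgradient_step M as \<epsilon>) (x\<^sub>0, x\<^sub>0, \<rho>) =
      Done (x, xb, max_dist A xb) (n * k) n"
    and xb: "xb \<in> M" "max_dist A xb \<le> \<rho>"
    and bound: "real n * (2 * \<epsilon> * (max_dist A xb - ?r)) \<le> (dist x\<^sub>0 ?c)\<^sup>2 + real n * \<epsilon>\<^sup>2"
    using repeat_subgradient_step[OF assms(1) _ _ x0 eps, of n] assms(3,10) ne len
    by (auto simp: \<rho>_def)
  have "k - 1 + n * k = k * (n + 1) - 1" using \<open>k > 0\<close> by (simp add: algebra_simps)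
  then have run: "circumcenter_subgradient M as x\<^sub>0 n = Done xb (k * (n + 1) - 1) n"
    using max_dist_filter_neq[of x\<^sub>0 as] assms(10,11) rep len'
    unfolding circumcenter_subgradient_def compute_dists_eq bind_comp_Done Let_def map_is_Nil_conv
    by (simp add: return_def \<rho>_def[symmetric] s_def[symmetric] \<epsilon>_def[symmetric])
  have c_le: "dist x\<^sub>0 ?c \<le> \<rho>"
    using dist_circumcenter_le[OF assms(4,11), of M]
      circumcenter_minimizes(2)[OF assms(1,4) ne assms(3) x0] by (simp add: \<rho>_def dist_commute)
  have "max_dist A xb - ?r \<le> 2 * \<rho> / s"
  proof (cases "\<rho> = 0")
    case True
    have "0 \<le> ?r" unfolding circumradius_def by (rule max_dist_nonneg[OF assms(4) ne])
    then show ?thesis using xb(2) True by simp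
  next
    case False
    then have "\<rho> > 0" using \<rho>0 by simp
    have "(dist x\<^sub>0 ?c)\<^sup>2 \<le> \<rho>\<^sup>2" using c_le by (intro power_mono) auto
    moreover have "real n * (2 * \<epsilon> * (max_dist A xb - ?r)) = \<rho> * (4 * s * (max_dist A xb - ?r))"
      "real n * \<epsilon>\<^sup>2 = \<rho> * (4 * \<rho>)"
      unfolding s2[symmetric] \<epsilon>_def using s4 by (auto simp: power2_eq_square field_simps)
    ultimately have "\<rho> * (4 * s * (max_dist A xb - ?r)) \<le> \<rho> * (5 * \<rho>)"
      using bound unfolding power2_eq_square by linarith
    then have "4 * s * (max_dist A xb - ?r) \<le> 5 * \<rho>" using \<open>\<rho> > 0\<close> by simp
    then have "s * (max_dist A xb - ?r) \<le> 2 * \<rho>" using \<rho>0 by simp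
    then show ?thesis using s4 by (simp add: field_simps)
  qed
  also have "\<rho> \<le> \<mu>"
  proof -
    obtain a where "a \<in> A" "\<rho> = dist x\<^sub>0 a"
      unfolding \<rho>_def using max_dist_attained[OF assms(4) ne] .
    then show ?thesis
      using diameter_bounded_bound[OF finite_imp_bounded[OF assms(4)] assms(11)] assms(7) by simp
  qed
  then have "2 * \<rho> / s \<le> 2 * \<mu> / s" using s4 by (intro divide_right_mono) auto
  finally have "max_dist A xb \<le> ?r + 2 * \<mu> / s" by simp
  then have "\<forall>a\<in>A. dist xb a \<le> ?r + 2 * \<mu> / s"
    using dist_le_max_dist[OF assms(4)] order_trans by blast
  then show ?thesis using run xb(1) by (auto simp: s_def)
qed

end
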